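(* Let $k$ be a positive integer and let $h \geq 2$ be an integer. Put $m = 2^{\lfloor \log_2 h \rfloor + 1}k - 1$ and $n = \binom{m+h-1}{h}$. Then \[\nu(\mathbb{Z}_n, m, h) < \min\left\{n, \binom{m+h-1}{h}\right\}.\]
   Context: $\mathbb{Z}_n$ denotes the additive cyclic group of order $n$, and $\lfloor x \rfloor$ is the greatest integer $\le x$. For a finite subset $A = \{a_1,\dots,a_m\}$ of an additive abelian group $G$ and an integer $h \ge 0$, the $h$-fold sumset is $hA = \{\sum_{i=1}^m \lambda_i a_i : \lambda_i \in \{0,1,\dots,h\},\ \sum_{i=1}^m \lambda_i = h\}$. For positive integers $m,h$, $\nu(G,m,h) = \max\{|hA| : A \subseteq G,\ |A| = m\}$. *)

theory Defs
  imports Complex_Main "HOL-Algebra.FiniteProduct" "HOL-Algebra.Elementary_Groups"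
begin

(* HOL-Algebra writes groups multiplicatively: finprod is the sum over A in the abelian
   group G, and a [^] c is the multiple c a.  The cyclic group of order n > 0 is
   integer_mod_group n, with carrier {0..<n} and addition modulo n. *)

definition hfold_sumset :: "('a, 'b) monoid_scheme \<Rightarrow> nat \<Rightarrow> 'a set \<Rightarrow> 'a set" where
  "hfold_sumset G h A =
     {finprod G (\<lambda>a. a [^]\<^bsub>G\<^esub> c a) A | c :: 'a \<Rightarrow> nat.
        (\<forall>a\<in>A. c a \<in> {0..h}) \<and> (\<Sum>a\<in>A. c a) = h}"

(* For an abelian group G the set below is finite, its elements being at most (h + 1) ^ m.
   Max is meaningful when it is nonempty, i.e. when carrier G has a finite subset with
   m elements. *)
definition max_sumset_card :: "('a, 'b) monoid_scheme \<Rightarrow> nat \<Rightarrow> nat \<Rightarrow> nat" where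
  "max_sumset_card G m h =
     Max {card (hfold_sumset G h A) | A. A \<subseteq> carrier G \<and> finite A \<and> card A = m}"

end

theory Submission
  imports Defs "HOL-Library.Multiset" "HOL-Combinatorics.Transposition"
begin

(* If some A of size m had |hA| = n, the sums of the n multisets of size h over A would run
   through each residue mod n exactly once.  By symmetry every a in A occurs h n / m times
   in total in these multisets; adding up all residues and multiplying by m gives
   h n (sum of A) = m n (n - 1) / 2 mod n.  But n is even and m is odd, so the right-hand
   side is n / 2 mod n, while the left-hand side is 0. *)

lemma finprod_integer_mod_group:
  assumes "finite A" and "A \<subseteq> carrier (integer_mod_group n)"
  shows "finprod (integer_mod_group n) (\<lambda>a. a [^]\<^bsub>integer_mod_group n\<^esub> c a) A
           = (\<Sum>a\<in>A. int (c a) * a) mod int n"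
  using assms
proof (induction A rule: finite_induct)
  case empty
  interpret comm_group "integer_mod_group n" by simp
  show ?case by simp
next
  case (insert x F)
  interpret comm_group "integer_mod_group n" by simp
  have pow: "a [^]\<^bsub>integer_mod_group n\<^esub> c a \<in> carrier (integer_mod_group n)"
    if "a \<in> insert x F" for a
    using insert.prems that by (intro nat_pow_closed) blast
  have "finprod (integer_mod_group n) (\<lambda>a. a [^]\<^bsub>integer_mod_group n\<^esub> c a) (insert x F)
      = x [^]\<^bsub>integer_mod_group n\<^esub> c x \<otimes>\<^bsub>integer_mod_group n\<^esub>
        finprod (integer_mod_group n) (\<lambda>a. a [^]\<^bsub>integer_mod_group n\<^esub> c a) F"
    using insert.hyps pow by (intro finprod_insert) auto
  also have "\<dots> = (int (c x) * x + (\<Sum>a\<in>F. int (c a) * a)) mod int n"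
    using insert by (simp add: mod_add_eq)
  finally show ?case using insert.hyps by simp
qed

text \<open>Coefficients with total \<open>h\<close> are the multiplicities of a multiset of size
  \<open>h\<close> over \<open>A\<close>. Passing to multisets gives an index set whose cardinality
  is a known binomial coefficient.\<close>

lemma hfold_sumset_integer_mod_group:
  assumes "finite A" and "A \<subseteq> carrier (integer_mod_group n)"
  shows "hfold_sumset (integer_mod_group n) h A \<subseteq>
           (\<lambda>X. \<Sum>\<^sub># X mod int n) ` multisets_of_size A h"
proof
  fix y assume "y \<in> hfold_sumset (integer_mod_group n) h A"
  then obtain c where y: "y = (\<Sum>a\<in>A. int (c a) * a) mod int n" and c: "(\<Sum>a\<in>A. c a) = h"
    unfolding hfold_sumset_def using finprod_integer_mod_group[OF assms] by auto
  define X where "X = (\<Sum>a\<in>A. replicate_mset (c a) a)"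
  have "set_mset (\<Sum>a\<in>B. replicate_mset (c a) a) \<subseteq> B
      \<and> size (\<Sum>a\<in>B. replicate_mset (c a) a) = (\<Sum>a\<in>B. c a)
      \<and> \<Sum>\<^sub># (\<Sum>a\<in>B. replicate_mset (c a) a) = (\<Sum>a\<in>B. int (c a) * a)"
    if "finite B" for B
    using that by (induction B rule: finite_induct) auto
  then have "X \<in> multisets_of_size A h" and "\<Sum>\<^sub># X = (\<Sum>a\<in>A. int (c a) * a)"
    using assms(1) c by (auto simp: X_def multisets_of_size_def)
  then show "y \<in> (\<lambda>X. \<Sum>\<^sub># X mod int n) ` multisets_of_size A h"
    using y by force
qed

text \<open>Swapping \<open>a\<close> and \<open>b\<close> inside every multiset is an involution of
  the index set, and it turns the multiplicity of \<open>a\<close> into that of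
  \<open>b\<close>.\<close>

lemma sum_count_multisets_of_size_eq:
  assumes "a \<in> A" and "b \<in> A"
  shows "(\<Sum>X\<in>multisets_of_size A h. count X a) = (\<Sum>X\<in>multisets_of_size A h. count X b)"
proof -
  let ?t = "image_mset (transpose a b)"
  have tt: "?t (?t X) = X" for X by (simp add: multiset.map_comp)
  have closed: "?t X \<in> multisets_of_size A h" if "X \<in> multisets_of_size A h" for X
    using that assms by (auto simp: multisets_of_size_def transpose_def)
  have count: "count (?t X) b = count X a" for X
    by (induction X) (auto simp: transpose_def)
  show ?thesis
    by (rule sum.reindex_bij_witness[where i = ?t and j = ?t]) (simp_all add: tt closed count)
qed

text \<open>Double counting: by symmetry the left side is the total of all multiplicities of all
  elements of \<open>A\<close>, and each multiset contributes its size \<open>h\<close> to that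
  total.\<close>

lemma card_mult_sum_count_multisets_of_size:
  assumes "finite A" and "a \<in> A"
  shows "card A * (\<Sum>X\<in>multisets_of_size A h. count X a) = h * card (multisets_of_size A h)"
proof -
  have "card A * (\<Sum>X\<in>multisets_of_size A h. count X a)
      = (\<Sum>b\<in>A. \<Sum>X\<in>multisets_of_size A h. count X a)"
    by simp
  also have "\<dots> = (\<Sum>b\<in>A. \<Sum>X\<in>multisets_of_size A h. count X b)"
    using assms(2) by (intro sum.cong refl sum_count_multisets_of_size_eq)
  also have "\<dots> = (\<Sum>X\<in>multisets_of_size A h. \<Sum>b\<in>A. count X b)"
    by (rule sum.swap)
  also have "\<dots> = (\<Sum>X\<in>multisets_of_size A h. h)"
  proof (rule sum.cong[OF refl])
    fix X assume "X \<in> multisets_of_size A h"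
    then have "set_mset X \<subseteq> A" "size X = h" by (auto simp: multisets_of_size_def)
    then show "(\<Sum>b\<in>A. count X b) = h"
      using sum.mono_neutral_left[of A "set_mset X" "count X"] assms(1)
      by (simp add: size_multiset_overloaded_eq not_in_iff)
  qed
  finally show ?thesis by (simp add: mult.commute)
qed

text \<open>Each \<open>a\<close> enters the grand total as often as its total multiplicity, which
  is the same for all of \<open>A\<close>. The factor \<open>card A\<close> avoids dividing by
  it.\<close>

lemma card_mult_sum_sum_mset_multisets_of_size:
  fixes A :: "int set"
  assumes "finite A"
  shows "int (card A) * (\<Sum>X\<in>multisets_of_size A h. \<Sum>\<^sub># X)
           = int (h * card (multisets_of_size A h)) * \<Sum>A"
proof -
  have sum_mset_eq: "\<Sum>\<^sub># X = (\<Sum>a\<in>A. int (count X a) * a)" if "set_mset X \<subseteq> A" for X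
    using that
  proof (induction X)
    case (add x X)
    have "(\<Sum>a\<in>A. int (count (add_mset x X) a) * a)
        = (\<Sum>a\<in>A. int (count X a) * a + (if a = x then a else 0))"
      by (intro sum.cong) (auto simp: algebra_simps)
    also have "\<dots> = (\<Sum>a\<in>A. int (count X a) * a) + x"
      using add.prems assms by (simp add: sum.distrib)
    finally show ?case using add by simp
  qed simp
  then have sm: "\<Sum>\<^sub># X = (\<Sum>a\<in>A. int (count X a) * a)" if "X \<in> multisets_of_size A h" for X
    using that by (simp add: multisets_of_size_def)
  have "int (card A) * (\<Sum>X\<in>multisets_of_size A h. \<Sum>\<^sub># X)
      = int (card A) * (\<Sum>a\<in>A. \<Sum>X\<in>multisets_of_size A h. int (count X a) * a)"
    by (simp add: sm sum.swap[of _ "multisets_of_size A h"])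
  also have "\<dots> = (\<Sum>a\<in>A. int (card A * (\<Sum>X\<in>multisets_of_size A h. count X a)) * a)"
    by (simp add: sum_distrib_left sum_distrib_right mult.assoc)
  also have "\<dots> = int (h * card (multisets_of_size A h)) * \<Sum>A"
    using card_mult_sum_count_multisets_of_size[OF assms] by (simp add: sum_distrib_left)
  finally show ?thesis .
qed

lemma card_hfold_sumset_less:
  assumes "finite A" and "A \<subseteq> carrier (integer_mod_group n)"
    and "n = (card A + h - 1) choose h" and "even n" and "n > 0" and "odd (card A)"
  shows "card (hfold_sumset (integer_mod_group n) h A) < n"
proof (rule ccontr)
  define M where "M = multisets_of_size A h"
  define f where "f = (\<lambda>X. \<Sum>\<^sub># X mod int n)"
  have M: "finite M" "card M = n"
    using assms(1,3) card_multisets_of_size[OF assms(1), of h] finite_multisets_of_size[OF assms(1), of h]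
    by (simp_all add: M_def)
  assume "\<not> card (hfold_sumset (integer_mod_group n) h A) < n"
  \<comment> \<open>The sumset lies in the image of \<open>f\<close>, and \<open>M\<close> has only
    \<open>n\<close> elements, so \<open>f\<close> must be a bijection from \<open>M\<close> onto
    the residues.\<close>
  then have "n \<le> card (f ` M)"
    using hfold_sumset_integer_mod_group[OF assms(1,2), of h] M(1)
      card_mono[of "f ` M" "hfold_sumset (integer_mod_group n) h A"]
    by (simp add: M_def f_def)
  moreover have "card (f ` M) \<le> n" using card_image_le[OF M(1), of f] M(2) by simp
  ultimately have card: "card (f ` M) = n" by simp
  then have inj: "inj_on f M" using M by (simp add: eq_card_imp_inj_on)
  have "f ` M \<subseteq> {0..<int n}" using assms(5) by (auto simp: f_def)
  then have img: "f ` M = {0..<int n}" using card by (simp add: card_subset_eq)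
  obtain q where q: "n = 2 * q" using assms(4) by blast
  \<comment> \<open>Stated in doubled form to stay free of division; \<open>n = 2 * q\<close> later
    cancels the 2.\<close>
  have gauss: "2 * \<Sum>{0..<int p} = int p * (int p - 1)" for p
  proof (induction p)
    case (Suc p)
    have "{0..<int (Suc p)} = insert (int p) {0..<int p}" by auto
    with Suc show ?case by (simp add: algebra_simps)
  qed simp
  have "int (card A) * (\<Sum>X\<in>M. f X) mod int n = int (card A) * (\<Sum>X\<in>M. \<Sum>\<^sub># X) mod int n"
  proof -
    have "(\<Sum>X\<in>M. f X) mod int n = (\<Sum>X\<in>M. \<Sum>\<^sub># X) mod int n"
      unfolding f_def by (rule mod_sum_eq)
    then show ?thesis by (rule mod_mult_cong[OF refl])
  qed
  \<comment> \<open>The symmetric count makes this \<open>h * n\<close> times the sum of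
    \<open>A\<close>, a multiple of \<open>n\<close>.\<close>
  also have "\<dots> = 0"
    using card_mult_sum_sum_mset_multisets_of_size[OF assms(1), of h] M(2) by (simp add: M_def)
  finally have "int n dvd int (card A) * (\<Sum>X\<in>M. f X)" by (rule mod_0_imp_dvd)
  also have "(\<Sum>X\<in>M. f X) = \<Sum>{0..<int n}"
    using sum.reindex[OF inj, of "\<lambda>x. x"] img by simp
  also have "\<dots> = int q * (2 * int q - 1)" using gauss[of n] q by simp
  finally have "int q * 2 dvd int q * (int (card A) * (2 * int q - 1))"
    using q by (simp add: mult_ac)
  \<comment> \<open>Cancelling the nonzero factor \<open>q\<close> leaves 2 dividing a product of
    two odd numbers.\<close>
  then have "even (int (card A) * (2 * int q - 1))" using q assms(5) by simp
  then show False using assms(6) by simp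
qed

text \<open>In the absorption identity
  \<open>j * (N choose j) = N * ((N - 1) choose (j - 1))\<close> with \<open>N = 2 ^ r * k\<close>,
  an odd binomial would force all of \<open>2 ^ r\<close> to divide the smaller positive number
  \<open>j\<close>.\<close>

lemma even_choose_power_two_mult:
  assumes "0 < j" and "j < 2 ^ r"
  shows "even ((2 ^ r * k) choose j)"
proof (rule ccontr)
  assume odd: "odd ((2 ^ r * k) choose j)"
  have "j * ((2 ^ r * k) choose j) = 2 ^ r * k * ((2 ^ r * k - 1) choose (j - 1))"
    using assms(1) times_binomial_minus1_eq by blast
  then have "2 ^ r dvd j * ((2 ^ r * k) choose j)" by (simp add: mult.assoc)
  moreover have "coprime (2 ^ r) ((2 ^ r * k) choose j)" using odd by simp
  ultimately have "2 ^ r dvd j" using coprime_dvd_mult_left_iff by blast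
  then show False using assms by (simp add: nat_dvd_not_less)
qed

text \<open>Expand by Vandermonde: the term \<open>j = 0\<close> vanishes because
  \<open>i < h\<close>, and in every other term the first factor is even because
  \<open>0 < j < 2 ^ r\<close>.\<close>

lemma even_choose_power_two_mult_add:
  assumes "i < h" and "h < 2 ^ r"
  shows "even ((2 ^ r * k + i) choose h)"
proof -
  have "even (((2 ^ r * k) choose j) * (i choose (h - j)))" if "j \<le> h" for j
    using even_choose_power_two_mult[of j r k] assms that by (cases "j = 0") (auto simp: binomial_eq_0)
  then have "even (\<Sum>j\<le>h. ((2 ^ r * k) choose j) * (i choose (h - j)))"
    by (intro dvd_sum) simp
  then show ?thesis by (simp add: vandermonde)
qed

text \<open>Pascal's rule shows that the binomial does not decrease as \<open>h\<close> grows from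
  1, where it equals \<open>m\<close>. This guarantees that the group has subsets of size
  \<open>m\<close>.\<close>

lemma le_choose_add:
  fixes m h :: nat
  assumes "m > 0" and "h > 0"
  shows "m \<le> (m + h - 1) choose h"
  using assms(2)
proof (induction h rule: nat_induct_non_zero)
  case (Suc h)
  have "m + Suc h - 1 = Suc (m + h - 1)" using assms(1) by simp
  then show ?case using Suc.IH by (simp only: binomial_Suc_Suc)
qed simp

theorem theorem1p5:
  fixes k h m n :: nat
  assumes "k > 0" and "h \<ge> 2"
    and "m = 2 ^ (nat \<lfloor>log 2 (real h)\<rfloor> + 1) * k - 1"
    and "n = (m + h - 1) choose h"
  shows "max_sumset_card (integer_mod_group n) m h < min n ((m + h - 1) choose h)"
proof -
  define r where "r = nat \<lfloor>log 2 (real h)\<rfloor> + 1"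
  have m: "m = 2 ^ r * k - 1" using assms(3) by (simp add: r_def)
  have "log 2 (real h) < real r"
    unfolding r_def by linarith
  then have "real h < 2 powr real r" using assms(2) by (simp add: log_less_iff)
  then have h: "h < 2 ^ r" by (simp add: powr_realpow flip: of_nat_less_iff)
  have r: "even (2 ^ r * k)" "2 ^ r * k > 2"
  proof -
    show "even (2 ^ r * k)" by (simp add: r_def)
    have "2 ^ r > (2::nat)" using h assms(2) by linarith
    also have "2 ^ r \<le> 2 ^ r * k" using assms(1) by simp
    finally show "2 ^ r * k > 2" .
  qed
  have "Suc m = 2 ^ r * k" using m r(2) by simp
  then have "odd m" "m > 0" using r by (metis even_Suc, linarith)
  \<comment> \<open>The shape required by the parity lemma, with remainder \<open>h - 2 < h\<close>;
    the hypothesis \<open>h \<ge> 2\<close> keeps the subtraction exact.\<close>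
  have "m + h - 1 = 2 ^ r * k + (h - 2)" using m r assms(2) by simp
  then have "even n"
    using even_choose_power_two_mult_add[of "h - 2" h r k] h assms(2,4) by simp
  have "m \<le> n" using le_choose_add[of m h] \<open>m > 0\<close> assms(2,4) by simp
  then have "n > 0" using \<open>m > 0\<close> by simp
  define S where "S = {card (hfold_sumset (integer_mod_group n) h A) | A.
      A \<subseteq> carrier (integer_mod_group n) \<and> finite A \<and> card A = m}"
  have less: "x < n" if "x \<in> S" for x
    using that card_hfold_sumset_less \<open>odd m\<close> \<open>even n\<close> \<open>n > 0\<close> assms(4) by (auto simp: S_def)
  \<comment> \<open>\<open>Max\<close> obeys the elementwise bound only on a nonempty finite set;
    finiteness follows from the bound itself.\<close>
  have "S \<noteq> {}"
  proof -
    have "m \<le> card (carrier (integer_mod_group n))"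
      using \<open>m \<le> n\<close> \<open>n > 0\<close> by (simp add: carrier_integer_mod_group)
    then obtain A where "A \<subseteq> carrier (integer_mod_group n)" "card A = m" "finite A"
      by (rule obtain_subset_with_card_n)
    then show ?thesis by (auto simp: S_def)
  qed
  moreover have "finite S" using less by (meson finite_nat_set_iff_bounded)
  ultimately have "Max S < n" using less by simp
  then show ?thesis using assms(4) by (simp add: max_sumset_card_def S_def)
qed

end
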